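(* A network $N$ has the global lca-property if and only if, for every strict $K_{2,2}$-subdivision $H\subseteq N$, there exists a subgraph $H'\subseteq N$ that is an $X$-subdivision or an $X'$-subdivision and satisfies $L(H')=L(H)$ and $R(H')=R(H)$.
   Context: A DAG is a finite directed graph without loops and directed cycles. For a DAG $G$, $u\preceq_G v$ means there is a directed path from $v$ to $u$ (including $u=v$); $L(G)$ is the set of $\preceq_G$-minimal vertices (leaves) and $R(G)$ the set of $\preceq_G$-maximal vertices (roots). A network is a DAG with $|R(G)|=1$. For non-empty $A\subseteq V(G)$, $\mathrm{LCA}_G(A)$ is the set of $\preceq_G$-minimal vertices $v$ with $a\preceq_G v$ for all $a\in A$; $G$ has the global lca-property if $|\mathrm{LCA}_G(A)|=1$ for all non-empty $A\subseteq V(G)$. An edge-subdivision replaces an edge $(x,y)$ by edges $(x,z),(z,y)$ for a new vertex $z$; a subdivision of a graph $F$ is obtained by a sequence of edge-subdivisions; a subgraph $H\subseteq G$ is an $F$-subdivision if it is isomorphic to a subdivision of $F$. $K_{2,2}$ is the DAG with vertices $r_1,r_2,l_1,l_2$ and edges $(r_i,l_j)$, $1\le i,j\le 2$. A strict $K_{2,2}$-subdivision of $G$ is a $K_{2,2}$-subdivision $H\subseteq G$ such that the two vertices of $R(H)$ are $\preceq_G$-incomparable and the two vertices of $L(H)$ are $\preceq_G$-incomparable. $X$ is the DAG with vertices $r_1,r_2,v,l_1,l_2$ and edges $(r_i,v),(v,l_i)$, $i=1,2$; $X'$ is the DAG with vertices $r_1,r_2,v,w,l_1,l_2$ and edges $(v,w)$,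 $(r_i,v)$, $(w,l_i)$, $i=1,2$. *)

theory Defs
  imports "Graph_Theory.Pair_Digraph" "Graph_Theory.Digraph_Component"
    "Graph_Theory.Digraph_Isomorphism"
begin

locale dag = pair_digraph G for G :: "'a pair_pre_digraph" +
  assumes no_directed_cycle: "\<nexists>p. pre_digraph.cycle (with_proj G) p"

text \<open>Edges point away from the roots: a vertex lies below all of its ancestors.\<close>

definition below :: "'a \<Rightarrow> 'a pair_pre_digraph \<Rightarrow> 'a \<Rightarrow> bool"
    (\<open>(_ \<preceq>\<^bsub>_\<^esub> _)\<close> [51, 0, 51] 50) where
  "u \<preceq>\<^bsub>G\<^esub> v \<longleftrightarrow> v \<rightarrow>\<^sup>*\<^bsub>with_proj G\<^esub> u"

definition incomparable :: "'a pair_pre_digraph \<Rightarrow> 'a \<Rightarrow> 'a \<Rightarrow> bool" where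
  "incomparable G u v \<longleftrightarrow> \<not> u \<preceq>\<^bsub>G\<^esub> v \<and> \<not> v \<preceq>\<^bsub>G\<^esub> u"

definition minimal_in :: "'a pair_pre_digraph \<Rightarrow> 'a set \<Rightarrow> 'a set" where
  "minimal_in G S = {v \<in> S. \<forall>w \<in> S. w \<preceq>\<^bsub>G\<^esub> v \<longrightarrow> w = v}"

definition maximal_in :: "'a pair_pre_digraph \<Rightarrow> 'a set \<Rightarrow> 'a set" where
  "maximal_in G S = {v \<in> S. \<forall>w \<in> S. v \<preceq>\<^bsub>G\<^esub> w \<longrightarrow> w = v}"

definition leaves :: "'a pair_pre_digraph \<Rightarrow> 'a set" where
  "leaves G = minimal_in G (pverts G)"

definition roots :: "'a pair_pre_digraph \<Rightarrow> 'a set" where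
  "roots G = maximal_in G (pverts G)"

locale network = dag +
  assumes unique_root: "card (roots G) = 1"

definition LCA :: "'a pair_pre_digraph \<Rightarrow> 'a set \<Rightarrow> 'a set" where
  "LCA G A = minimal_in G {v \<in> pverts G. \<forall>a \<in> A. a \<preceq>\<^bsub>G\<^esub> v}"

definition global_lca_property :: "'a pair_pre_digraph \<Rightarrow> bool" where
  "global_lca_property G \<longleftrightarrow>
     (\<forall>A. A \<noteq> {} \<and> A \<subseteq> pverts G \<longrightarrow> card (LCA G A) = 1)"

text \<open>
  The subdivision notions of the imported entry concern symmetric digraphs: they replace an arc
  together with its reversal. Directed subdivision is therefore defined here.
\<close>

definition edge_subdivision ::
    "'a pair_pre_digraph \<Rightarrow> 'a \<times> 'a \<Rightarrow> 'a \<Rightarrow> 'a pair_pre_digraph" where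
  "edge_subdivision G e z =
     \<lparr> pverts = insert z (pverts G),
       parcs = (parcs G - {e}) \<union> {(fst e, z), (z, snd e)} \<rparr>"

inductive subdivision_of :: "'a pair_pre_digraph \<Rightarrow> 'a pair_pre_digraph \<Rightarrow> bool"
  for F :: "'a pair_pre_digraph" where
  refl: "subdivision_of F F"
| step: "\<lbrakk>subdivision_of F G; e \<in> parcs G; z \<notin> pverts G\<rbrakk>
    \<Longrightarrow> subdivision_of F (edge_subdivision G e z)"

text \<open>
  The pattern \<open>F\<close> and its subdivisions \<open>S\<close> live on natural numbers, so that fresh vertices
  are always available whatever the vertex type of \<open>G\<close>.
\<close>

definition subdivision_in ::
    "nat pair_pre_digraph \<Rightarrow> 'a pair_pre_digraph \<Rightarrow> 'a pair_pre_digraph \<Rightarrow> bool" where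
  "subdivision_in F G H \<longleftrightarrow>
     subgraph (with_proj H) (with_proj G) \<and>
     (\<exists>S. subdivision_of F S \<and> digraph_iso (with_proj S) (with_proj H))"

text \<open>In the three patterns, the roots are 0, 1 and the leaves are 2, 3.\<close>

definition K22 :: "nat pair_pre_digraph" where
  "K22 = \<lparr> pverts = {0, 1, 2, 3}, parcs = {(0, 2), (0, 3), (1, 2), (1, 3)} \<rparr>"

definition X_graph :: "nat pair_pre_digraph" where
  "X_graph = \<lparr> pverts = {0, 1, 2, 3, 4}, parcs = {(0, 4), (1, 4), (4, 2), (4, 3)} \<rparr>"

definition X'_graph :: "nat pair_pre_digraph" where
  "X'_graph =
     \<lparr> pverts = {0, 1, 2, 3, 4, 5}, parcs = {(0, 4), (1, 4), (4, 5), (5, 2), (5, 3)} \<rparr>"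

text \<open>
  Roots and leaves are those of \<open>H\<close>; incomparability is required in the ambient graph \<open>G\<close>.
\<close>

definition strict_K22_subdivision :: "'a pair_pre_digraph \<Rightarrow> 'a pair_pre_digraph \<Rightarrow> bool" where
  "strict_K22_subdivision G H \<longleftrightarrow>
     subdivision_in K22 G H \<and>
     (\<forall>u \<in> roots H. \<forall>v \<in> roots H. u \<noteq> v \<longrightarrow> incomparable G u v) \<and>
     (\<forall>u \<in> leaves H. \<forall>v \<in> leaves H. u \<noteq> v \<longrightarrow> incomparable G u v)"

end

(* The global lca-property holds iff any two vertices have a least common ancestor in the order of N
   (then finite joins exist).  If r1, r2 are two distinct elements of LCA(x, y), choose l1 above x
   and l2 above y maximal below both roots: paths from r1, r2 to l1, l2 can meet only at their
   ends, which gives a strict K22-subdivision, and a middle vertex of an X- or X'-subdivision with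
   the same roots and leaves would be a common ancestor of x, y below r1 and r2, forcing r1 = r2.
   Conversely, for a strict K22-subdivision the join w of the two leaves lies below both roots;
   with v maximal among the vertices above w and below both roots, any choice of paths
   r1, r2 -> v -> w -> l1, l2 gives an X-subdivision (v = w) or an X'-subdivision (v ~= w). *)

theory Submission
  imports Defs
begin

section \<open>Roots, leaves and subdivisions\<close>

text \<open>Reachability is reflexive on vertices only, which is why \<open>v\<close> must be a
  vertex; the other end is then one automatically, since arcs end in vertices.\<close>

lemma (in pair_digraph) below_eq_rtrancl:
  "u \<preceq>\<^bsub>G\<^esub> v \<longleftrightarrow> v \<in> pverts G \<and> (v, u) \<in> (parcs G)\<^sup>*"
proof -
  have "(v, u) \<in> (parcs G)\<^sup>* \<Longrightarrow> v \<in> pverts G \<Longrightarrow> u \<in> pverts G"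
    by (induction rule: rtrancl_induct) (auto dest: in_arcsD2)
  then show ?thesis
    unfolding below_def using reachable_conv by auto
qed

text \<open>The tail of an arc into \<open>v\<close> lies above \<open>v\<close> and differs from it
  because there are no loops; conversely, a nontrivial path to \<open>v\<close> ends in an arc into
  \<open>v\<close>. Roots thus become computable from the arc set alone.\<close>

lemma (in pair_digraph) roots_eq: "roots G = pverts G - snd ` parcs G"
proof -
  have "(\<forall>w \<in> pverts G. v \<preceq>\<^bsub>G\<^esub> w \<longrightarrow> w = v) \<longleftrightarrow> (\<forall>u. (u, v) \<notin> parcs G)" for v
  proof
    assume *: "\<forall>w \<in> pverts G. v \<preceq>\<^bsub>G\<^esub> w \<longrightarrow> w = v"
    show "\<forall>u. (u, v) \<notin> parcs G"
    proof (intro allI notI)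
      fix u assume "(u, v) \<in> parcs G"
      then have "u \<in> pverts G" "v \<preceq>\<^bsub>G\<^esub> u" "u \<noteq> v"
        by (auto simp: below_eq_rtrancl dest: in_arcsD1 no_loops')
      with * show False by blast
    qed
  qed (auto simp: below_eq_rtrancl elim: rtranclE)
  moreover have "v \<in> snd ` parcs G \<longleftrightarrow> (\<exists>u. (u, v) \<in> parcs G)" for v
    by force
  ultimately show ?thesis
    by (simp add: roots_def maximal_in_def set_diff_eq)
qed

lemma (in pair_digraph) leaves_eq: "leaves G = pverts G - fst ` parcs G"
proof -
  have "(\<forall>w \<in> pverts G. w \<preceq>\<^bsub>G\<^esub> v \<longrightarrow> w = v) \<longleftrightarrow> (\<forall>u. (v, u) \<notin> parcs G)" for v
  proof
    assume *: "\<forall>w \<in> pverts G. w \<preceq>\<^bsub>G\<^esub> v \<longrightarrow> w = v"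
    show "\<forall>u. (v, u) \<notin> parcs G"
    proof (intro allI notI)
      fix u assume "(v, u) \<in> parcs G"
      then have "u \<in> pverts G" "u \<preceq>\<^bsub>G\<^esub> v" "u \<noteq> v"
        by (auto simp: below_eq_rtrancl dest: in_arcsD1 in_arcsD2 no_loops')
      with * show False by blast
    qed
  qed (auto simp: below_eq_rtrancl elim: converse_rtranclE)
  moreover have "v \<in> fst ` parcs G \<longleftrightarrow> (\<exists>u. (v, u) \<in> parcs G)" for v
    by force
  ultimately show ?thesis
    by (simp add: leaves_def minimal_in_def set_diff_eq)
qed

section \<open>Invariants of edge-subdivision\<close>

lemma pair_digraph_edge_subdivision:
  assumes "pair_digraph G" "e \<in> parcs G" "z \<notin> pverts G"
  shows "pair_digraph (edge_subdivision G e z)"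
proof -
  interpret pair_digraph G by fact
  show ?thesis
    using assms(2,3) pair_finite_verts pair_finite_arcs
    by unfold_locales
      (auto simp: edge_subdivision_def dest: arc_fst_in_verts arc_snd_in_verts no_loops')
qed

lemma roots_edge_subdivision:
  assumes "pair_digraph G" "e \<in> parcs G" "z \<notin> pverts G"
  shows "roots (edge_subdivision G e z) = roots G"
proof -
  interpret G: pair_digraph G by fact
  interpret S: pair_digraph "edge_subdivision G e z"
    using assms by (rule pair_digraph_edge_subdivision)
  \<comment> \<open>The head of the deleted arc \<open>e\<close> survives as the head of
    \<open>(z, snd e)\<close>, so the only new head is \<open>z\<close>, which is also the only new
    vertex.\<close>
  have "snd ` parcs (edge_subdivision G e z) = insert z (snd ` parcs G)"
    using assms(2) by (force simp: edge_subdivision_def)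
  moreover have "pverts (edge_subdivision G e z) = insert z (pverts G)"
    by (simp add: edge_subdivision_def)
  ultimately show ?thesis
    using assms(3) by (auto simp: S.roots_eq G.roots_eq)
qed

lemma leaves_edge_subdivision:
  assumes "pair_digraph G" "e \<in> parcs G" "z \<notin> pverts G"
  shows "leaves (edge_subdivision G e z) = leaves G"
proof -
  interpret G: pair_digraph G by fact
  interpret S: pair_digraph "edge_subdivision G e z"
    using assms by (rule pair_digraph_edge_subdivision)
  have "fst ` parcs (edge_subdivision G e z) = insert z (fst ` parcs G)"
    using assms(2) by (force simp: edge_subdivision_def)
  moreover have "pverts (edge_subdivision G e z) = insert z (pverts G)"
    by (simp add: edge_subdivision_def)
  ultimately show ?thesis
    using assms(3) by (auto simp: S.leaves_eq G.leaves_eq)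
qed

lemma trancl_edge_subdivision:
  assumes "(u, v) \<in> (parcs G)\<^sup>+"
  shows "(u, v) \<in> (parcs (edge_subdivision G e z))\<^sup>+"
proof -
  have "(a, b) \<in> (parcs (edge_subdivision G e z))\<^sup>+" if "(a, b) \<in> parcs G" for a b
  proof (cases "e = (a, b)")
    case True
    then have "(a, z) \<in> parcs (edge_subdivision G e z)" "(z, b) \<in> parcs (edge_subdivision G e z)"
      by (auto simp: edge_subdivision_def)
    then show ?thesis by (meson r_into_trancl trancl_into_trancl)
  qed (use that in \<open>auto simp: edge_subdivision_def\<close>)
  with assms show ?thesis
    by (induction rule: trancl_induct) (blast intro: trancl_trans)+
qed

text \<open>One induction over the subdivision steps proves all five facts together: those about a
  single step assume a \<open>pair_digraph\<close>, so this property has to be carried along.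
  Reachability survives because the deleted arc turns into a path through the new vertex.\<close>

lemma
  assumes "subdivision_of F S" and F: "pair_digraph F"
  shows pair_digraph_subdivision: "pair_digraph S"
    and pverts_subdivision: "pverts F \<subseteq> pverts S"
    and roots_subdivision: "roots S = roots F"
    and leaves_subdivision: "leaves S = leaves F"
    and trancl_subdivision: "(u, v) \<in> (parcs F)\<^sup>+ \<Longrightarrow> (u, v) \<in> (parcs S)\<^sup>+"
proof -
  from assms(1) have "pair_digraph S \<and> pverts F \<subseteq> pverts S \<and> roots S = roots F \<and>
      leaves S = leaves F \<and> ((u, v) \<in> (parcs F)\<^sup>+ \<longrightarrow> (u, v) \<in> (parcs S)\<^sup>+)"
  proof induction
    case (step G e z)
    then show ?case
      by (auto simp: pair_digraph_edge_subdivision roots_edge_subdivision leaves_edge_subdivision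
          trancl_edge_subdivision)
        (auto simp: edge_subdivision_def)
  qed (use F in auto)
  then show "pair_digraph S" "pverts F \<subseteq> pverts S" "roots S = roots F" "leaves S = leaves F"
    "(u, v) \<in> (parcs F)\<^sup>+ \<Longrightarrow> (u, v) \<in> (parcs S)\<^sup>+"
    by auto
qed

section \<open>Subdivisions with prescribed branch vertices\<close>

definition map_pair_graph :: "('a \<Rightarrow> 'b) \<Rightarrow> 'a pair_pre_digraph \<Rightarrow> 'b pair_pre_digraph" where
  "map_pair_graph h S = \<lparr> pverts = h ` pverts S, parcs = map_prod h h ` parcs S \<rparr>"

lemma map_pair_graph_simps [simp]:
  "pverts (map_pair_graph h S) = h ` pverts S"
  "parcs (map_pair_graph h S) = map_prod h h ` parcs S"
  by (auto simp: map_pair_graph_def)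

lemma pair_digraph_map_pair_graph:
  assumes "pair_digraph S" "inj_on h (pverts S)"
  shows "pair_digraph (map_pair_graph h S)"
proof -
  interpret pair_digraph S by fact
  show ?thesis
  proof (unfold_locales; clarsimp)
    fix a b assume "(a, b) \<in> parcs S" "h a = h b"
    then show False
      using inj_onD[OF assms(2), of a b] no_loops' in_arcsD1 in_arcsD2 by blast
  qed (auto simp: pair_finite_verts pair_finite_arcs dest: in_arcsD1 in_arcsD2)
qed

lemma roots_map_pair_graph:
  assumes "pair_digraph S" "inj_on h (pverts S)"
  shows "roots (map_pair_graph h S) = h ` roots S"
proof -
  interpret S: pair_digraph S by fact
  interpret H: pair_digraph "map_pair_graph h S"
    using assms by (rule pair_digraph_map_pair_graph)
  have "snd ` parcs (map_pair_graph h S) = h ` snd ` parcs S"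
    by (force simp: image_iff)
  moreover have "snd ` parcs S \<subseteq> pverts S"
    using S.in_arcsD2 by auto
  ultimately show ?thesis
    using inj_on_image_set_diff[OF assms(2), of "pverts S" "snd ` parcs S"]
    by (simp add: S.roots_eq H.roots_eq)
qed

lemma leaves_map_pair_graph:
  assumes "pair_digraph S" "inj_on h (pverts S)"
  shows "leaves (map_pair_graph h S) = h ` leaves S"
proof -
  interpret S: pair_digraph S by fact
  interpret H: pair_digraph "map_pair_graph h S"
    using assms by (rule pair_digraph_map_pair_graph)
  have "fst ` parcs (map_pair_graph h S) = h ` fst ` parcs S"
    by (force simp: image_iff)
  moreover have "fst ` parcs S \<subseteq> pverts S"
    using S.in_arcsD1 by auto
  ultimately show ?thesis
    using inj_on_image_set_diff[OF assms(2), of "pverts S" "fst ` parcs S"]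
    by (simp add: S.leaves_eq H.leaves_eq)
qed

text \<open>An isomorphism record carries separate maps for vertices, arcs, tails and heads. Between
  graphs whose arcs are pairs, the last two must be the projections, and this forces the arc map to
  be \<open>map_prod\<close> of the vertex map; so isomorphic copies are exactly the injective
  images.\<close>

lemma digraph_iso_with_proj_iff:
  assumes "pair_digraph S"
  shows "digraph_iso (with_proj S) (with_proj H) \<longleftrightarrow>
    (\<exists>h. inj_on h (pverts S) \<and> H = map_pair_graph h S)"
proof
  assume "digraph_iso (with_proj S) (with_proj H)"
  then obtain i where i: "pre_digraph.digraph_isomorphism (with_proj S) i"
    and H: "with_proj H = app_iso i (with_proj S)"
    unfolding digraph_iso_def by blast
  have proj: "iso_tail i = fst" "iso_head i = snd"
    using arg_cong[OF H, of tail] arg_cong[OF H, of head] by auto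
  have "iso_arcs i e = map_prod (iso_verts i) (iso_verts i) e" if "e \<in> parcs S" for e
    using i that unfolding pre_digraph.digraph_isomorphism_def proj
    by (auto simp: prod_eq_iff)
  then have "iso_arcs i ` parcs S = map_prod (iso_verts i) (iso_verts i) ` parcs S"
    by (rule image_cong[OF HOL.refl])
  then have "H = map_pair_graph (iso_verts i) S"
    using arg_cong[OF H, of verts] arg_cong[OF H, of arcs]
    by (intro pair_pre_digraph.equality) auto
  moreover have "inj_on (iso_verts i) (pverts S)"
    using i by (auto simp: pre_digraph.digraph_isomorphism_def)
  ultimately show "\<exists>h. inj_on h (pverts S) \<and> H = map_pair_graph h S"
    by blast
next
  assume "\<exists>h. inj_on h (pverts S) \<and> H = map_pair_graph h S"
  then obtain h where h: "inj_on h (pverts S)" and H: "H = map_pair_graph h S"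
    by blast
  interpret pair_digraph S by fact
  define i where "i = \<lparr> iso_verts = h, iso_arcs = map_prod h h, iso_head = snd, iso_tail = fst \<rparr>"
  have "inj_on (map_prod h h) (parcs S)"
    using map_prod_inj_on[OF h h] by (rule inj_on_subset) (auto dest: in_arcsD1 in_arcsD2)
  then have "pre_digraph.digraph_isomorphism (with_proj S) i"
    unfolding pre_digraph.digraph_isomorphism_def i_def
    using h wf_digraph by auto
  moreover have "with_proj H = app_iso i (with_proj S)"
    by (simp add: H with_proj_def app_iso_def i_def)
  ultimately show "digraph_iso (with_proj S) (with_proj H)"
    unfolding digraph_iso_def by blast
qed

text \<open>Names the positions \<open>f\<close> of the branch vertices, which
  \<open>subdivision_in\<close> hides behind an existential. Only the values of \<open>f\<close> on
  \<open>pverts F\<close> matter.\<close>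

definition subdivision_via ::
    "nat pair_pre_digraph \<Rightarrow> (nat \<Rightarrow> 'a) \<Rightarrow> 'a pair_pre_digraph \<Rightarrow> bool" where
  "subdivision_via F f H \<longleftrightarrow>
     (\<exists>S h. subdivision_of F S \<and> inj_on h (pverts S) \<and> (\<forall>x \<in> pverts F. h x = f x) \<and>
            H = map_pair_graph h S)"

lemma subdivision_in_iff_via:
  assumes F: "pair_digraph F"
  shows "subdivision_in F G H \<longleftrightarrow>
    subgraph (with_proj H) (with_proj G) \<and> (\<exists>f. subdivision_via F f H)"
proof -
  have "(\<exists>S. subdivision_of F S \<and> digraph_iso (with_proj S) (with_proj H)) \<longleftrightarrow>
      (\<exists>S h. subdivision_of F S \<and> inj_on h (pverts S) \<and> H = map_pair_graph h S)"
    using digraph_iso_with_proj_iff[OF pair_digraph_subdivision[OF _ F]] by metis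
  also have "\<dots> \<longleftrightarrow> (\<exists>f. subdivision_via F f H)"
    unfolding subdivision_via_def by metis
  finally show ?thesis
    unfolding subdivision_in_def by simp
qed

text \<open>What holds for \<open>S\<close> carries over along the injective \<open>h\<close>.
  Roots, leaves and arcs of \<open>F\<close> involve only vertices of \<open>F\<close>, where
  \<open>h\<close> and \<open>f\<close> agree, so the results can be stated through
  \<open>f\<close>.\<close>

lemma
  assumes "subdivision_via F f H" and F: "pair_digraph F"
  shows pair_digraph_via: "pair_digraph H"
    and inj_on_via: "inj_on f (pverts F)"
    and pverts_via: "f ` pverts F \<subseteq> pverts H"
    and roots_via: "roots H = f ` roots F"
    and leaves_via: "leaves H = f ` leaves F"
    and trancl_via: "(a, b) \<in> (parcs F)\<^sup>+ \<Longrightarrow> (f a, f b) \<in> (parcs H)\<^sup>+"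
proof -
  obtain S h where S: "subdivision_of F S" and h: "inj_on h (pverts S)"
    and f: "\<And>x. x \<in> pverts F \<Longrightarrow> h x = f x" and H: "H = map_pair_graph h S"
    using assms(1) by (auto simp: subdivision_via_def)
  interpret F: pair_digraph F by fact
  note S_props = pair_digraph_subdivision[OF S F] pverts_subdivision[OF S F]
  show "pair_digraph H"
    unfolding H using S_props(1) h by (rule pair_digraph_map_pair_graph)
  show "inj_on f (pverts F)"
    using inj_on_subset[OF h S_props(2)] f by (simp cong: inj_on_cong)
  show "f ` pverts F \<subseteq> pverts H"
    using S_props(2) f by (force simp: H)
  have "h ` A = f ` A" if "A \<subseteq> pverts F" for A
    using that f by (intro image_cong) auto
  then show "roots H = f ` roots F" "leaves H = f ` leaves F"
    using roots_map_pair_graph[OF S_props(1) h] leaves_map_pair_graph[OF S_props(1) h]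
    by (auto simp: H roots_subdivision[OF S F] leaves_subdivision[OF S F] F.roots_eq F.leaves_eq)
  assume ab: "(a, b) \<in> (parcs F)\<^sup>+"
  have "(h x, h y) \<in> (parcs H)\<^sup>+" if "(x, y) \<in> (parcs S)\<^sup>+" for x y
    using that
  proof (induction rule: trancl_induct)
    case (base y)
    then show ?case by (force simp: H)
  next
    case (step y z)
    then have "(h y, h z) \<in> parcs H" by (force simp: H)
    with step.IH show ?case by (rule trancl_into_trancl)
  qed
  moreover have "a \<in> pverts F" "b \<in> pverts F"
    using F.reachable1_in_verts[OF ab] by auto
  ultimately show "(f a, f b) \<in> (parcs H)\<^sup>+"
    using trancl_subdivision[OF S F ab] f by metis
qed

text \<open>The step is pulled back to the pattern side: \<open>e\<close> is the image of an arc
  \<open>d\<close> of \<open>S\<close>, and as \<open>S\<close> is finite there is a fresh number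
  \<open>n\<close>, which the extended map sends to \<open>z\<close>.\<close>

lemma subdivision_via_edge_subdivision:
  assumes via: "subdivision_via F f H" and F: "pair_digraph F"
    and e: "e \<in> parcs H" and z: "z \<notin> pverts H"
  shows "subdivision_via F f (edge_subdivision H e z)"
proof -
  obtain S h where S: "subdivision_of F S" and h: "inj_on h (pverts S)"
    and f: "\<And>x. x \<in> pverts F \<Longrightarrow> h x = f x" and H: "H = map_pair_graph h S"
    using via by (auto simp: subdivision_via_def)
  interpret S: pair_digraph S
    using S F by (rule pair_digraph_subdivision)
  obtain d where d: "d \<in> parcs S" "e = map_prod h h d"
    using e by (auto simp: H)
  obtain n where n: "n \<notin> pverts S"
    using S.pair_finite_verts ex_new_if_finite infinite_UNIV_nat by blast
  define h' where "h' = h(n := z)"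
  have h': "h' x = h x" if "x \<in> pverts S" for x
    using that n by (auto simp: h'_def)
  have inj: "inj_on (map_prod h h) (parcs S)"
    using map_prod_inj_on[OF h h] by (rule inj_on_subset) (auto dest: S.in_arcsD1 S.in_arcsD2)
  have "map_prod h' h' ` (parcs S - {d}) = map_prod h h ` (parcs S - {d})"
    by (rule image_cong) (auto simp: h'[OF S.in_arcsD1] h'[OF S.in_arcsD2])
  also have "\<dots> = parcs H - {e}"
    using inj_on_image_set_diff[OF inj, of "parcs S" "{d}"] d by (simp add: H)
  finally have arcs: "map_prod h' h' ` (parcs S - {d}) = parcs H - {e}" .
  have verts: "h' ` pverts S = pverts H"
    using h' by (auto simp: H)
  have "h' (fst d) = fst e" "h' (snd d) = snd e" "h' n = z"
    using d S.arc_fst_in_verts S.arc_snd_in_verts by (auto simp: h', auto simp: h'_def)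
  then have "edge_subdivision H e z = map_pair_graph h' (edge_subdivision S d n)"
    using arcs verts by (simp add: edge_subdivision_def map_pair_graph_def image_Un)
  moreover have "inj_on h' (pverts (edge_subdivision S d n))"
    using h n z verts by (auto simp: edge_subdivision_def h' H h'_def inj_on_def)
  moreover have "\<forall>x \<in> pverts F. h' x = f x"
    using h' f pverts_subdivision[OF S F] by auto
  ultimately show ?thesis
    unfolding subdivision_via_def using subdivision_of.step[OF S d(1) n] by blast
qed

section \<open>Replacing arcs by paths\<close>

fun walk_arcs :: "'a \<Rightarrow> 'a list \<Rightarrow> 'a \<Rightarrow> ('a \<times> 'a) set" where
  "walk_arcs x [] y = {(x, y)}"
| "walk_arcs x (z # zs) y = insert (x, z) (walk_arcs z zs y)"

lemma walk_arcs_verts: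
  "(u, v) \<in> walk_arcs x zs y \<Longrightarrow> u \<in> insert x (set zs) \<and> v \<in> insert y (set zs)"
  by (induction zs arbitrary: x) auto

text \<open>In a path with inner vertices every arc has an inner end, and without them the only arc
  is \<open>(x, y)\<close>. This keeps inserted paths apart from arcs not yet replaced.\<close>

lemma walk_arcs_inner:
  "(u, v) \<in> walk_arcs x zs y \<Longrightarrow> u = x \<and> v = y \<or> u \<in> set zs \<or> v \<in> set zs"
  by (induction zs arbitrary: x) (auto dest: walk_arcs_verts)

text \<open>Induction on \<open>zs\<close>: subdividing \<open>(x, y)\<close> by the first inner
  vertex \<open>z\<close> leaves the arc \<open>(z, y)\<close>, into which the remaining vertices
  are then inserted.\<close>

lemma subdivision_via_replace_arc:
  assumes "subdivision_via F f H" and F: "pair_digraph F"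
    and "(x, y) \<in> parcs H" and "distinct zs" and "set zs \<inter> pverts H = {}"
  shows "subdivision_via F f
    \<lparr> pverts = pverts H \<union> set zs, parcs = (parcs H - {(x, y)}) \<union> walk_arcs x zs y \<rparr>"
  using assms(1,3-)
proof (induction zs arbitrary: x H)
  case Nil
  then have "\<lparr> pverts = pverts H \<union> set [], parcs = (parcs H - {(x, y)}) \<union> walk_arcs x [] y \<rparr> = H"
    by (simp add: insert_absorb)
  with Nil.prems show ?case by simp
next
  case (Cons z zs)
  interpret H: pair_digraph H
    using Cons.prems(1) F by (rule pair_digraph_via)
  let ?H = "edge_subdivision H (x, y) z"
  have "subdivision_via F f
      \<lparr> pverts = pverts ?H \<union> set zs, parcs = (parcs ?H - {(z, y)}) \<union> walk_arcs z zs y \<rparr>"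
    using Cons.prems
    by (intro Cons.IH subdivision_via_edge_subdivision F) (auto simp: edge_subdivision_def)
  \<comment> \<open>Since \<open>z\<close> is not a vertex of \<open>H\<close>, removing
    \<open>(z, y)\<close> again takes no old arc away.\<close>
  moreover have "parcs ?H - {(z, y)} = insert (x, z) (parcs H - {(x, y)})"
    using Cons.prems(2,4) by (auto simp: edge_subdivision_def dest: H.in_arcsD1)
  ultimately show ?case
    by (simp add: edge_subdivision_def)
qed

lemma subdivision_via_map_pair_graph:
  assumes "inj_on f (pverts F)"
  shows "subdivision_via F f (map_pair_graph f F)"
  unfolding subdivision_via_def using subdivision_of.refl assms by blast

text \<open>The arcs are replaced one at a time. In the proof, \<open>?H E\<close> is the stage
  where the arcs in \<open>E\<close> have become paths and all others are still single arcs: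
  \<open>E = {}\<close> gives the plain copy of \<open>F\<close>, \<open>E = parcs F\<close> the
  desired graph.\<close>

lemma subdivision_via_replace_arcs:
  fixes inner :: "nat \<times> nat \<Rightarrow> 'a list"
  assumes F: "pair_digraph F" and inj: "inj_on f (pverts F)"
    and dist: "\<And>e. e \<in> parcs F \<Longrightarrow> distinct (inner e)"
    and fresh: "\<And>e. e \<in> parcs F \<Longrightarrow> set (inner e) \<inter> f ` pverts F = {}"
    and disj: "\<And>e d. e \<in> parcs F \<Longrightarrow> d \<in> parcs F \<Longrightarrow> e \<noteq> d \<Longrightarrow>
      set (inner e) \<inter> set (inner d) = {}"
  shows "subdivision_via F f
    \<lparr> pverts = f ` pverts F \<union> (\<Union>e\<in>parcs F. set (inner e)),
      parcs = (\<Union>e\<in>parcs F. walk_arcs (f (fst e)) (inner e) (f (snd e))) \<rparr>"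
proof -
  interpret F: pair_digraph F by fact
  let ?walk = "\<lambda>e. walk_arcs (f (fst e)) (inner e) (f (snd e))"
  let ?H = "\<lambda>E. \<lparr> pverts = f ` pverts F \<union> (\<Union>e\<in>E. set (inner e)),
      parcs = map_prod f f ` (parcs F - E) \<union> (\<Union>e\<in>E. ?walk e) \<rparr>"
  have "subdivision_via F f (?H E)" if "finite E" "E \<subseteq> parcs F" for E
    using that
  proof (induction E)
    case empty
    then show ?case
      using subdivision_via_map_pair_graph[OF inj] by (simp add: map_pair_graph_def)
  next
    case (insert e E)
    let ?e = "(f (fst e), f (snd e))"
    have inj2: "inj_on (map_prod f f) (parcs F)"
      using map_prod_inj_on[OF inj inj] by (rule inj_on_subset) (auto dest: F.in_arcsD1 F.in_arcsD2)
    have e: "e \<in> parcs F" "E \<subseteq> parcs F"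
      using insert.prems by auto
    have ends: "f (fst e) \<in> f ` pverts F" "f (snd e) \<in> f ` pverts F"
      using e F.arc_fst_in_verts F.arc_snd_in_verts by auto
    \<comment> \<open>Both ends of \<open>?e\<close> are branch vertices, so on the path of
      \<open>d\<close> it could only join the two ends of \<open>d\<close>; injectivity would then
      give \<open>e = d\<close>.\<close>
    have "?e \<notin> ?walk d" if "d \<in> E" for d
    proof
      assume *: "?e \<in> ?walk d"
      have "d \<in> parcs F" using that e by auto
      then have "set (inner d) \<inter> f ` pverts F = {}"
        by (rule fresh)
      with walk_arcs_inner[OF *] ends
      have "f (fst e) = f (fst d) \<and> f (snd e) = f (snd d)" by blast
      then have "map_prod f f e = map_prod f f d"
        by (cases e; cases d) auto
      then have "e = d"
        using inj2 e(1) \<open>d \<in> parcs F\<close> by (blast dest: inj_onD)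
      with that insert.hyps show False by simp
    qed
    then have walks: "(\<Union>e\<in>E. ?walk e) - {?e} = (\<Union>e\<in>E. ?walk e)"
      by blast
    have img: "map_prod f f ` (parcs F - E) - {?e} = map_prod f f ` (parcs F - insert e E)"
    proof -
      have "map_prod f f ` (parcs F - E - {e}) = map_prod f f ` (parcs F - E) - map_prod f f ` {e}"
        using e by (intro inj_on_image_set_diff[OF inj2]) auto
      moreover have "parcs F - E - {e} = parcs F - insert e E"
        by blast
      moreover have "map_prod f f ` {e} = {?e}"
        by (cases e) simp
      ultimately show ?thesis
        by simp
    qed
    have arcs: "parcs (?H E) - {?e} = map_prod f f ` (parcs F - insert e E) \<union> (\<Union>e\<in>E. ?walk e)"
      by (simp only: pair_pre_digraph.simps Un_Diff img walks)
    have "subdivision_via F f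
        \<lparr> pverts = pverts (?H E) \<union> set (inner e), parcs = (parcs (?H E) - {?e}) \<union> ?walk e \<rparr>"
    proof (rule subdivision_via_replace_arc[OF _ F])
      show "subdivision_via F f (?H E)" using insert.IH e(2) .
      show "?e \<in> parcs (?H E)"
        using e(1) insert.hyps by (auto intro!: image_eqI[of _ _ e] simp: prod_eq_iff)
      show "distinct (inner e)" using dist e by blast
      have "set (inner e) \<inter> set (inner d) = {}" if "d \<in> E" for d
        using disj[of e d] that e insert.hyps by auto
      then show "set (inner e) \<inter> pverts (?H E) = {}"
        using fresh[OF e(1)] by auto
    qed
    then show ?case
      unfolding arcs by (simp add: Un_assoc Un_commute[of "set (inner e)"] Un_commute[of "?walk e"])
  qed
  from this[OF F.pair_finite_arcs] show ?thesis by simp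
qed

section \<open>The order of a DAG\<close>

context dag
begin

lemma below_refl: "v \<in> pverts G \<Longrightarrow> v \<preceq>\<^bsub>G\<^esub> v"
  by (simp add: below_eq_rtrancl)

lemma below_trans: "u \<preceq>\<^bsub>G\<^esub> v \<Longrightarrow> v \<preceq>\<^bsub>G\<^esub> w \<Longrightarrow> u \<preceq>\<^bsub>G\<^esub> w"
  by (auto simp: below_eq_rtrancl)

lemma below_verts:
  assumes "u \<preceq>\<^bsub>G\<^esub> v" shows "u \<in> pverts G" "v \<in> pverts G"
  using assms reachable_in_verts unfolding below_def by auto

lemma trancl_irrefl: "(u, u) \<notin> (parcs G)\<^sup>+"
proof
  assume "(u, u) \<in> (parcs G)\<^sup>+"
  then obtain p where "awalk u p u" "p \<noteq> []"
    using reachable1_awalk by auto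
  then have "closed_w p"
    unfolding closed_w_def by auto
  then show False
    using closed_w_imp_cycle no_directed_cycle by blast
qed

lemma below_antisym: "u \<preceq>\<^bsub>G\<^esub> v \<Longrightarrow> v \<preceq>\<^bsub>G\<^esub> u \<Longrightarrow> u = v"
  unfolding below_eq_rtrancl by (metis rtranclD rtrancl_trancl_trancl trancl_irrefl)

text \<open>Every arc leads strictly downwards, so a walk built by prepending arcs never repeats a
  vertex, and its inner vertices lie strictly between the ends.\<close>

lemma below_walk:
  assumes "b \<preceq>\<^bsub>G\<^esub> a" "a \<noteq> b"
  obtains zs where "walk_arcs a zs b \<subseteq> parcs G" "distinct zs"
    "\<And>z. z \<in> set zs \<Longrightarrow> b \<preceq>\<^bsub>G\<^esub> z \<and> z \<preceq>\<^bsub>G\<^esub> a \<and> z \<noteq> a \<and> z \<noteq> b"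
proof -
  have "(a, b) \<in> (parcs G)\<^sup>*"
    using assms(1) by (simp add: below_eq_rtrancl)
  then have "a \<noteq> b \<longrightarrow> (\<exists>zs. walk_arcs a zs b \<subseteq> parcs G \<and> distinct zs \<and>
      (\<forall>z \<in> set zs. b \<preceq>\<^bsub>G\<^esub> z \<and> z \<preceq>\<^bsub>G\<^esub> a \<and> z \<noteq> a \<and> z \<noteq> b))"
  proof (induction rule: converse_rtrancl_induct)
    case (step x y)
    have yx: "y \<preceq>\<^bsub>G\<^esub> x" "x \<noteq> y"
      using step.hyps(1) no_loops' by (auto simp: below_eq_rtrancl dest: in_arcsD1)
    have bly: "b \<preceq>\<^bsub>G\<^esub> y"
      using step.hyps by (auto simp: below_eq_rtrancl dest: in_arcsD2)
    show ?case
    proof (cases "y = b")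
      case True
      then show ?thesis
        using step.hyps(1) by (intro impI exI[of _ "[]"]) auto
    next
      case False
      then obtain zs where zs: "walk_arcs y zs b \<subseteq> parcs G" "distinct zs"
        "\<forall>z \<in> set zs. b \<preceq>\<^bsub>G\<^esub> z \<and> z \<preceq>\<^bsub>G\<^esub> y \<and> z \<noteq> y \<and> z \<noteq> b"
        using step.IH by blast
      show ?thesis
      proof (intro impI exI[of _ "y # zs"] conjI)
        show "\<forall>z \<in> set (y # zs). b \<preceq>\<^bsub>G\<^esub> z \<and> z \<preceq>\<^bsub>G\<^esub> x \<and> z \<noteq> x \<and> z \<noteq> b"
          using zs(3) yx bly False by (auto intro: below_trans dest: below_antisym)
      qed (use zs step.hyps(1) in auto)
    qed
  qed simp
  then show ?thesis
    using assms(2) that by blast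
qed

text \<open>
  Order conditions replace disjointness of paths: an inner vertex of a path from \<open>f a\<close> to
  \<open>f b\<close> lies strictly between the two, whatever path is chosen.
\<close>

lemma subdivision_in_if_order_embedding:
  assumes F: "pair_digraph F" and inj: "inj_on f (pverts F)"
    and verts: "f ` pverts F \<subseteq> pverts G"
    and arcs: "\<And>a b. (a, b) \<in> parcs F \<Longrightarrow> f b \<preceq>\<^bsub>G\<^esub> f a"
    and no_branch: "\<And>a b c. (a, b) \<in> parcs F \<Longrightarrow> c \<in> pverts F \<Longrightarrow>
      f b \<preceq>\<^bsub>G\<^esub> f c \<Longrightarrow> f c \<preceq>\<^bsub>G\<^esub> f a \<Longrightarrow> c = a \<or> c = b"
    and no_crossing: "\<And>a b a' b' u. (a, b) \<in> parcs F \<Longrightarrow> (a', b') \<in> parcs F \<Longrightarrow>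
      (a, b) \<noteq> (a', b') \<Longrightarrow> f b \<preceq>\<^bsub>G\<^esub> u \<Longrightarrow> u \<preceq>\<^bsub>G\<^esub> f a \<Longrightarrow> f b' \<preceq>\<^bsub>G\<^esub> u \<Longrightarrow> u \<preceq>\<^bsub>G\<^esub> f a' \<Longrightarrow>
      u \<in> f ` pverts F"
  obtains H where "subdivision_in F G H" "roots H = f ` roots F" "leaves H = f ` leaves F"
proof -
  interpret F: pair_digraph F by fact
  let ?P = "\<lambda>e zs. walk_arcs (f (fst e)) zs (f (snd e)) \<subseteq> parcs G \<and> distinct zs \<and>
    (\<forall>z \<in> set zs. f (snd e) \<preceq>\<^bsub>G\<^esub> z \<and> z \<preceq>\<^bsub>G\<^esub> f (fst e) \<and> z \<noteq> f (fst e) \<and> z \<noteq> f (snd e))"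
  have "\<exists>zs. ?P e zs" if "e \<in> parcs F" for e
  proof -
    have "f (fst e) \<noteq> f (snd e)"
      using inj that F.arc_fst_in_verts F.arc_snd_in_verts F.pair_no_loops
      by (auto dest: inj_onD)
    moreover have "f (snd e) \<preceq>\<^bsub>G\<^esub> f (fst e)"
      using arcs that by simp
    ultimately show ?thesis
      using below_walk by metis
  qed
  then obtain inner where inner: "\<And>e. e \<in> parcs F \<Longrightarrow> ?P e (inner e)"
    by metis
  \<comment> \<open>A branch vertex on the path of \<open>e\<close> lies between the ends of
    \<open>e\<close>, so by \<open>no_branch\<close> it would be one of these ends, which
    \<open>below_walk\<close> excludes.\<close>
  have fresh: "set (inner e) \<inter> f ` pverts F = {}" if "e \<in> parcs F" for e
    using inner[OF that] no_branch[of "fst e" "snd e"] that by fastforce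
  \<comment> \<open>A common inner vertex lies between the ends of both arcs;
    \<open>no_crossing\<close> turns it into a branch vertex, against \<open>fresh\<close>.\<close>
  have disj: "set (inner e) \<inter> set (inner d) = {}" if "e \<in> parcs F" "d \<in> parcs F" "e \<noteq> d" for e d
  proof (rule ccontr)
    assume "\<not> ?thesis"
    then obtain u where u: "u \<in> set (inner e)" "u \<in> set (inner d)" by blast
    then have "u \<in> f ` pverts F"
      using no_crossing[of "fst e" "snd e" "fst d" "snd d" u] inner that by auto
    then show False
      using fresh[OF that(1)] u by blast
  qed
  define H where "H = \<lparr> pverts = f ` pverts F \<union> (\<Union>e\<in>parcs F. set (inner e)),
      parcs = (\<Union>e\<in>parcs F. walk_arcs (f (fst e)) (inner e) (f (snd e))) \<rparr>"
  have via: "subdivision_via F f H"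
    unfolding H_def using inner fresh disj by (intro subdivision_via_replace_arcs[OF F inj]) auto
  interpret H: pair_digraph H
    using via F by (rule pair_digraph_via)
  have "subgraph (with_proj H) (with_proj G)"
    unfolding subgraph_def
  proof (intro conjI)
    show "verts (with_proj H) \<subseteq> verts (with_proj G)"
      using verts inner below_verts(1) by (auto simp: H_def) blast
    show "arcs (with_proj H) \<subseteq> arcs (with_proj G)"
      using inner by (auto simp: H_def)
  qed (use wf_digraph H.wf_digraph in \<open>auto simp: compatible_def\<close>)
  then have "subdivision_in F G H"
    using via subdivision_in_iff_via[OF F] by blast
  then show ?thesis
    using roots_via[OF via F] leaves_via[OF via F] by (rule that)
qed

text \<open>From a given subdivision only the order between branch vertices is kept, not the
  disjointness of its paths: a path of \<open>H\<close> is also a path of \<open>G\<close>.\<close>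

lemma subdivision_in_branch_vertices:
  assumes F: "pair_digraph F" and "subdivision_in F G H"
  obtains f where "inj_on f (pverts F)" "f ` pverts F \<subseteq> pverts G"
    "roots H = f ` roots F" "leaves H = f ` leaves F"
    "\<And>a b. (a, b) \<in> (parcs F)\<^sup>+ \<Longrightarrow> f b \<preceq>\<^bsub>G\<^esub> f a"
proof -
  obtain f where sub: "subgraph (with_proj H) (with_proj G)" and via: "subdivision_via F f H"
    using assms(2) subdivision_in_iff_via[OF F] by blast
  interpret F: pair_digraph F by fact
  have H: "pverts H \<subseteq> pverts G" "parcs H \<subseteq> parcs G"
    using sub by (auto simp: subgraph_def)
  show ?thesis
  proof
    fix a b assume ab: "(a, b) \<in> (parcs F)\<^sup>+"
    have "(f a, f b) \<in> (parcs G)\<^sup>+"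
      using trancl_via[OF via F ab] H(2) by (rule trancl_mono)
    moreover have "f a \<in> pverts G"
      using calculation by (rule reachable1_in_verts)
    ultimately show "f b \<preceq>\<^bsub>G\<^esub> f a"
      by (simp add: below_eq_rtrancl trancl_into_rtrancl)
  qed (use inj_on_via[OF via F] pverts_via[OF via F] roots_via[OF via F] leaves_via[OF via F] H(1)
      in auto)
qed

section \<open>Extremal elements and joins\<close>

lemma
  assumes "v \<in> S" "S \<subseteq> pverts G"
  shows ex_minimal_below: "\<exists>m \<in> minimal_in G S. m \<preceq>\<^bsub>G\<^esub> v"
    and ex_maximal_above: "\<exists>m \<in> maximal_in G S. v \<preceq>\<^bsub>G\<^esub> m"
proof -
  have fin: "finite S"
    using assms(2) pair_finite_verts by (rule finite_subset)
  have v: "v \<preceq>\<^bsub>G\<^esub> v"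
    using assms below_refl by auto
  define lt where "lt = (\<lambda>x y. x \<preceq>\<^bsub>G\<^esub> y \<and> x \<noteq> y)"
  have lt: "asymp_on S lt" "transp_on S lt"
    by (auto simp: lt_def intro!: asymp_onI transp_onI dest: below_antisym intro: below_trans)
  obtain m where "m \<in> S" "m \<preceq>\<^bsub>G\<^esub> v" "\<forall>x \<in> S. lt x m \<longrightarrow> \<not> x \<preceq>\<^bsub>G\<^esub> v"
    using Finite_Set.bex_min_element_with_property[OF fin lt, of "\<lambda>x. x \<preceq>\<^bsub>G\<^esub> v"] assms(1) v by blast
  \<comment> \<open>Minimality was obtained only among the elements below \<open>v\<close>; anything
    in \<open>S\<close> below \<open>m\<close> is below \<open>v\<close> by transitivity.\<close>
  then show "\<exists>m \<in> minimal_in G S. m \<preceq>\<^bsub>G\<^esub> v"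
    unfolding minimal_in_def lt_def using below_trans by blast
  obtain m where "m \<in> S" "v \<preceq>\<^bsub>G\<^esub> m" "\<forall>x \<in> S. lt m x \<longrightarrow> \<not> v \<preceq>\<^bsub>G\<^esub> x"
    using Finite_Set.bex_max_element_with_property[OF fin lt, of "\<lambda>x. v \<preceq>\<^bsub>G\<^esub> x"] assms(1) v by blast
  then show "\<exists>m \<in> maximal_in G S. v \<preceq>\<^bsub>G\<^esub> m"
    unfolding maximal_in_def lt_def using below_trans by blast
qed

text \<open>The least upper bound of \<open>A\<close> in the order of \<open>G\<close>, where
  \<open>LCA\<close> collects the minimal upper bounds.\<close>

definition is_join :: "'a set \<Rightarrow> 'a \<Rightarrow> bool" where
  "is_join A j \<longleftrightarrow> j \<in> pverts G \<and> (\<forall>a \<in> A. a \<preceq>\<^bsub>G\<^esub> j) \<and>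
     (\<forall>w \<in> pverts G. (\<forall>a \<in> A. a \<preceq>\<^bsub>G\<^esub> w) \<longrightarrow> j \<preceq>\<^bsub>G\<^esub> w)"

text \<open>By finiteness every common ancestor has a minimal one below it, so a unique minimal one
  is least; conversely, antisymmetry leaves no minimal element besides a least one.\<close>

lemma card_LCA_eq_1_iff: "card (LCA G A) = 1 \<longleftrightarrow> (\<exists>j. is_join A j)"
proof
  assume "card (LCA G A) = 1"
  then obtain j where j: "LCA G A = {j}"
    by (auto simp: card_1_singleton_iff)
  have "j \<preceq>\<^bsub>G\<^esub> w" if "w \<in> pverts G" "\<forall>a \<in> A. a \<preceq>\<^bsub>G\<^esub> w" for w
    using ex_minimal_below[of w "{v \<in> pverts G. \<forall>a \<in> A. a \<preceq>\<^bsub>G\<^esub> v}"] that j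
    unfolding LCA_def by auto
  moreover have "j \<in> LCA G A" using j by simp
  ultimately show "\<exists>j. is_join A j"
    unfolding is_join_def LCA_def minimal_in_def by blast
next
  assume "\<exists>j. is_join A j"
  then obtain j where "is_join A j" ..
  then have "LCA G A = {j}"
    unfolding is_join_def LCA_def minimal_in_def using below_antisym by blast
  then show "card (LCA G A) = 1" by simp
qed

text \<open>Joins of finite nonempty sets are iterated binary joins, and all vertex sets are
  finite.\<close>

lemma global_lca_property_iff_pairs:
  "global_lca_property G \<longleftrightarrow> (\<forall>x \<in> pverts G. \<forall>y \<in> pverts G. \<exists>j. is_join {x, y} j)"
proof
  assume "global_lca_property G"
  then show "\<forall>x \<in> pverts G. \<forall>y \<in> pverts G. \<exists>j. is_join {x, y} j"
    unfolding global_lca_property_def card_LCA_eq_1_iff by simp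
next
  assume pairs: "\<forall>x \<in> pverts G. \<forall>y \<in> pverts G. \<exists>j. is_join {x, y} j"
  have "\<exists>j. is_join A j" if "finite A" "A \<noteq> {}" "A \<subseteq> pverts G" for A
    using that
  proof (induction rule: finite_ne_induct)
    case (singleton x)
    then show ?case
      by (intro exI[of _ x]) (auto simp: is_join_def below_refl)
  next
    case (insert x A)
    then obtain i where i: "is_join A i" by auto
    then have "i \<in> pverts G" by (simp add: is_join_def)
    with insert.prems pairs obtain j where j: "is_join {x, i} j" by blast
    \<comment> \<open>A vertex above all of \<open>A\<close> is above the join \<open>i\<close> of
      \<open>A\<close>, so \<open>insert x A\<close> and \<open>{x, i}\<close> have the same upper
      bounds.\<close>
    have "is_join (insert x A) j"
      using i j unfolding is_join_def by (auto intro: below_trans)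
    then show ?case ..
  qed
  then show "global_lca_property G"
    unfolding global_lca_property_def card_LCA_eq_1_iff
    using pair_finite_verts finite_subset by metis
qed

end

section \<open>The three patterns\<close>

lemma
  shows pair_digraph_K22: "pair_digraph K22"
    and pair_digraph_X: "pair_digraph X_graph"
    and pair_digraph_X': "pair_digraph X'_graph"
  by (unfold_locales; auto simp: K22_def X_graph_def X'_graph_def)+

lemma roots_leaves_patterns:
  "roots K22 = {0, 1}" "leaves K22 = {2, 3}"
  "roots X_graph = {0, 1}" "leaves X_graph = {2, 3}"
  "roots X'_graph = {0, 1}" "leaves X'_graph = {2, 3}"
  unfolding pair_digraph.roots_eq[OF pair_digraph_K22] pair_digraph.leaves_eq[OF pair_digraph_K22]
    pair_digraph.roots_eq[OF pair_digraph_X] pair_digraph.leaves_eq[OF pair_digraph_X]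
    pair_digraph.roots_eq[OF pair_digraph_X'] pair_digraph.leaves_eq[OF pair_digraph_X']
  by (auto simp: K22_def X_graph_def X'_graph_def)

context dag
begin

text \<open>Only the order relations between the four branch vertices enter the rest of the proof.
  Injectivity of \<open>f\<close> keeps the two roots, and the two leaves, distinct, so that
  strictness applies to them.\<close>

lemma strict_K22_subdivision_branch_vertices:
  assumes "strict_K22_subdivision G H"
  obtains r\<^sub>1 r\<^sub>2 l\<^sub>1 l\<^sub>2 where "roots H = {r\<^sub>1, r\<^sub>2}" "leaves H = {l\<^sub>1, l\<^sub>2}"
    "incomparable G r\<^sub>1 r\<^sub>2" "incomparable G l\<^sub>1 l\<^sub>2"
    "l\<^sub>1 \<preceq>\<^bsub>G\<^esub> r\<^sub>1" "l\<^sub>1 \<preceq>\<^bsub>G\<^esub> r\<^sub>2" "l\<^sub>2 \<preceq>\<^bsub>G\<^esub> r\<^sub>1" "l\<^sub>2 \<preceq>\<^bsub>G\<^esub> r\<^sub>2"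
proof -
  have "subdivision_in K22 G H"
    using assms by (simp add: strict_K22_subdivision_def)
  then obtain f where f: "inj_on f (pverts K22)"
    "roots H = {f 0, f 1}" "leaves H = {f 2, f 3}"
    "\<And>a b. (a, b) \<in> (parcs K22)\<^sup>+ \<Longrightarrow> f b \<preceq>\<^bsub>G\<^esub> f a"
    by (rule subdivision_in_branch_vertices[OF pair_digraph_K22])
      (auto simp: roots_leaves_patterns)
  have "f 0 \<noteq> f 1" "f 2 \<noteq> f 3"
    using f(1) by (auto simp: K22_def)
  moreover have "f 2 \<preceq>\<^bsub>G\<^esub> f 0" "f 2 \<preceq>\<^bsub>G\<^esub> f 1" "f 3 \<preceq>\<^bsub>G\<^esub> f 0" "f 3 \<preceq>\<^bsub>G\<^esub> f 1"
    by (intro f(4) r_into_trancl; simp add: K22_def)+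
  ultimately show ?thesis
    using that[OF f(2,3)] assms f(2,3) by (simp add: strict_K22_subdivision_def)
qed

text \<open>In both patterns every path from a root to a leaf runs through vertex \<open>4\<close>;
  in \<open>X'_graph\<close> the leaves lie below it by way of \<open>5\<close>.\<close>

lemma X_subdivision_middle_vertex:
  assumes "subdivision_in X_graph G H \<or> subdivision_in X'_graph G H"
  obtains m where "\<forall>r \<in> roots H. m \<preceq>\<^bsub>G\<^esub> r" "\<forall>l \<in> leaves H. l \<preceq>\<^bsub>G\<^esub> m"
  using assms
proof
  assume "subdivision_in X_graph G H"
  then obtain f where f: "roots H = {f 0, f 1}" "leaves H = {f 2, f 3}"
    "\<And>a b. (a, b) \<in> (parcs X_graph)\<^sup>+ \<Longrightarrow> f b \<preceq>\<^bsub>G\<^esub> f a"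
    by (rule subdivision_in_branch_vertices[OF pair_digraph_X])
      (auto simp: roots_leaves_patterns)
  have "f 4 \<preceq>\<^bsub>G\<^esub> f 0" "f 4 \<preceq>\<^bsub>G\<^esub> f 1" "f 2 \<preceq>\<^bsub>G\<^esub> f 4" "f 3 \<preceq>\<^bsub>G\<^esub> f 4"
    by (intro f(3) r_into_trancl; simp add: X_graph_def)+
  then show ?thesis
    using that[of "f 4"] f(1,2) by auto
next
  assume "subdivision_in X'_graph G H"
  then obtain f where f: "roots H = {f 0, f 1}" "leaves H = {f 2, f 3}"
    "\<And>a b. (a, b) \<in> (parcs X'_graph)\<^sup>+ \<Longrightarrow> f b \<preceq>\<^bsub>G\<^esub> f a"
    by (rule subdivision_in_branch_vertices[OF pair_digraph_X'])
      (auto simp: roots_leaves_patterns)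
  have "f 4 \<preceq>\<^bsub>G\<^esub> f 0" "f 4 \<preceq>\<^bsub>G\<^esub> f 1" "f 5 \<preceq>\<^bsub>G\<^esub> f 4" "f 2 \<preceq>\<^bsub>G\<^esub> f 5" "f 3 \<preceq>\<^bsub>G\<^esub> f 5"
    by (intro f(3) r_into_trancl; simp add: X'_graph_def)+
  then show ?thesis
    using that[of "f 4"] f(1,2) by (auto intro: below_trans)
qed

text \<open>By \<open>up\<close>, paths from the two roots to \<open>v\<close> meet only in
  \<open>v\<close>, and by \<open>down\<close> so do paths from \<open>v\<close> to the two leaves;
  antisymmetry separates upper from lower paths. Hence the five vertices form an order embedding in
  the required sense.\<close>

lemma ex_X_subdivision:
  assumes r: "incomparable G r\<^sub>1 r\<^sub>2" and l: "incomparable G l\<^sub>1 l\<^sub>2"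
    and v: "v \<preceq>\<^bsub>G\<^esub> r\<^sub>1" "v \<preceq>\<^bsub>G\<^esub> r\<^sub>2" "l\<^sub>1 \<preceq>\<^bsub>G\<^esub> v" "l\<^sub>2 \<preceq>\<^bsub>G\<^esub> v"
    and up: "\<And>u. v \<preceq>\<^bsub>G\<^esub> u \<Longrightarrow> u \<preceq>\<^bsub>G\<^esub> r\<^sub>1 \<Longrightarrow> u \<preceq>\<^bsub>G\<^esub> r\<^sub>2 \<Longrightarrow> u = v"
    and down: "\<And>u. l\<^sub>1 \<preceq>\<^bsub>G\<^esub> u \<Longrightarrow> l\<^sub>2 \<preceq>\<^bsub>G\<^esub> u \<Longrightarrow> u \<preceq>\<^bsub>G\<^esub> v \<Longrightarrow> u = v"
  shows "\<exists>H. subdivision_in X_graph G H \<and> roots H = {r\<^sub>1, r\<^sub>2} \<and> leaves H = {l\<^sub>1, l\<^sub>2}"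
proof -
  \<comment> \<open>Position \<open>i\<close> of the list is the image of pattern vertex
    \<open>i\<close>: roots \<open>0\<close>, \<open>1\<close>, leaves \<open>2\<close>,
    \<open>3\<close>, middle vertex \<open>4\<close>.\<close>
  let ?f = "(!) [r\<^sub>1, r\<^sub>2, l\<^sub>1, l\<^sub>2, v]"
  have incomp: "\<not> r\<^sub>1 \<preceq>\<^bsub>G\<^esub> r\<^sub>2" "\<not> r\<^sub>2 \<preceq>\<^bsub>G\<^esub> r\<^sub>1" "\<not> l\<^sub>1 \<preceq>\<^bsub>G\<^esub> l\<^sub>2" "\<not> l\<^sub>2 \<preceq>\<^bsub>G\<^esub> l\<^sub>1"
    using r l by (auto simp: incomparable_def)
  have verts: "r\<^sub>1 \<in> pverts G" "r\<^sub>2 \<in> pverts G" "l\<^sub>1 \<in> pverts G" "l\<^sub>2 \<in> pverts G" "v \<in> pverts G"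
    using v below_verts by blast+
  have lr: "l\<^sub>1 \<preceq>\<^bsub>G\<^esub> r\<^sub>1" "l\<^sub>1 \<preceq>\<^bsub>G\<^esub> r\<^sub>2" "l\<^sub>2 \<preceq>\<^bsub>G\<^esub> r\<^sub>1" "l\<^sub>2 \<preceq>\<^bsub>G\<^esub> r\<^sub>2"
    using v below_trans by blast+
  have ne: "r\<^sub>1 \<noteq> r\<^sub>2" "l\<^sub>1 \<noteq> l\<^sub>2" "v \<noteq> r\<^sub>1" "v \<noteq> r\<^sub>2" "l\<^sub>1 \<noteq> v" "l\<^sub>2 \<noteq> v"
      "l\<^sub>1 \<noteq> r\<^sub>1" "l\<^sub>1 \<noteq> r\<^sub>2" "l\<^sub>2 \<noteq> r\<^sub>1" "l\<^sub>2 \<noteq> r\<^sub>2"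
    using v lr incomp verts below_refl by blast+
  note ne = ne ne[symmetric]
  have img: "?f ` pverts X_graph = {r\<^sub>1, r\<^sub>2, l\<^sub>1, l\<^sub>2, v}"
    by (auto simp: X_graph_def)
  have inj: "inj_on ?f (pverts X_graph)"
    using ne by (auto simp: X_graph_def)
  show ?thesis
  proof (rule subdivision_in_if_order_embedding[OF pair_digraph_X inj])
    show "?f ` pverts X_graph \<subseteq> pverts G"
      unfolding img using verts by simp
    show "?f b \<preceq>\<^bsub>G\<^esub> ?f a" if "(a, b) \<in> parcs X_graph" for a b
      using that v by (auto simp: X_graph_def)
    show "c = a \<or> c = b" if "(a, b) \<in> parcs X_graph" "c \<in> pverts X_graph"
      "?f b \<preceq>\<^bsub>G\<^esub> ?f c" "?f c \<preceq>\<^bsub>G\<^esub> ?f a" for a b c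
      using that ne incomp lr v by (auto simp: X_graph_def dest: below_antisym)
    show "u \<in> ?f ` pverts X_graph"
      if "(a, b) \<in> parcs X_graph" "(a', b') \<in> parcs X_graph" "(a, b) \<noteq> (a', b')"
        "?f b \<preceq>\<^bsub>G\<^esub> u" "u \<preceq>\<^bsub>G\<^esub> ?f a" "?f b' \<preceq>\<^bsub>G\<^esub> u" "u \<preceq>\<^bsub>G\<^esub> ?f a'" for a b a' b' u
      unfolding img using that up down by (auto simp: X_graph_def dest: below_antisym)
  qed (auto simp: roots_leaves_patterns)
qed

lemma ex_X'_subdivision:
  assumes r: "incomparable G r\<^sub>1 r\<^sub>2" and l: "incomparable G l\<^sub>1 l\<^sub>2"
    and v: "v \<preceq>\<^bsub>G\<^esub> r\<^sub>1" "v \<preceq>\<^bsub>G\<^esub> r\<^sub>2" and w: "l\<^sub>1 \<preceq>\<^bsub>G\<^esub> w" "l\<^sub>2 \<preceq>\<^bsub>G\<^esub> w" and wv: "w \<preceq>\<^bsub>G\<^esub> v" "w \<noteq> v"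
    and up: "\<And>u. v \<preceq>\<^bsub>G\<^esub> u \<Longrightarrow> u \<preceq>\<^bsub>G\<^esub> r\<^sub>1 \<Longrightarrow> u \<preceq>\<^bsub>G\<^esub> r\<^sub>2 \<Longrightarrow> u = v"
    and down: "\<And>u. l\<^sub>1 \<preceq>\<^bsub>G\<^esub> u \<Longrightarrow> l\<^sub>2 \<preceq>\<^bsub>G\<^esub> u \<Longrightarrow> u \<preceq>\<^bsub>G\<^esub> w \<Longrightarrow> u = w"
  shows "\<exists>H. subdivision_in X'_graph G H \<and> roots H = {r\<^sub>1, r\<^sub>2} \<and> leaves H = {l\<^sub>1, l\<^sub>2}"
proof -
  let ?f = "(!) [r\<^sub>1, r\<^sub>2, l\<^sub>1, l\<^sub>2, v, w]"
  have incomp: "\<not> r\<^sub>1 \<preceq>\<^bsub>G\<^esub> r\<^sub>2" "\<not> r\<^sub>2 \<preceq>\<^bsub>G\<^esub> r\<^sub>1" "\<not> l\<^sub>1 \<preceq>\<^bsub>G\<^esub> l\<^sub>2" "\<not> l\<^sub>2 \<preceq>\<^bsub>G\<^esub> l\<^sub>1"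
    using r l by (auto simp: incomparable_def)
  have verts: "r\<^sub>1 \<in> pverts G" "r\<^sub>2 \<in> pverts G" "l\<^sub>1 \<in> pverts G" "l\<^sub>2 \<in> pverts G" "v \<in> pverts G"
      "w \<in> pverts G"
    using v w below_verts by blast+
  have rel: "w \<preceq>\<^bsub>G\<^esub> r\<^sub>1" "w \<preceq>\<^bsub>G\<^esub> r\<^sub>2" "l\<^sub>1 \<preceq>\<^bsub>G\<^esub> v" "l\<^sub>2 \<preceq>\<^bsub>G\<^esub> v"
    using v w wv below_trans by blast+
  have lr: "l\<^sub>1 \<preceq>\<^bsub>G\<^esub> r\<^sub>1" "l\<^sub>1 \<preceq>\<^bsub>G\<^esub> r\<^sub>2" "l\<^sub>2 \<preceq>\<^bsub>G\<^esub> r\<^sub>1" "l\<^sub>2 \<preceq>\<^bsub>G\<^esub> r\<^sub>2"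
    using v rel below_trans by blast+
  have ne: "r\<^sub>1 \<noteq> r\<^sub>2" "l\<^sub>1 \<noteq> l\<^sub>2" "v \<noteq> r\<^sub>1" "v \<noteq> r\<^sub>2" "l\<^sub>1 \<noteq> v" "l\<^sub>2 \<noteq> v"
      "w \<noteq> r\<^sub>1" "w \<noteq> r\<^sub>2" "l\<^sub>1 \<noteq> w" "l\<^sub>2 \<noteq> w" "l\<^sub>1 \<noteq> r\<^sub>1" "l\<^sub>1 \<noteq> r\<^sub>2" "l\<^sub>2 \<noteq> r\<^sub>1" "l\<^sub>2 \<noteq> r\<^sub>2"
    using v w rel lr incomp verts below_refl by blast+
  note ne = ne ne[symmetric] wv(2) wv(2)[symmetric]
  have img: "?f ` pverts X'_graph = {r\<^sub>1, r\<^sub>2, l\<^sub>1, l\<^sub>2, v, w}"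
    by (auto simp: X'_graph_def)
  have inj: "inj_on ?f (pverts X'_graph)"
    using ne by (auto simp: X'_graph_def)
  \<comment> \<open>Paths from the roots to \<open>v\<close> stay above \<open>v\<close>, and paths
    from \<open>w\<close> to the leaves stay below \<open>w\<close>; as \<open>w\<close> is strictly
    below \<open>v\<close>, they share no vertex.\<close>
  have "\<not> (v \<preceq>\<^bsub>G\<^esub> u \<and> u \<preceq>\<^bsub>G\<^esub> w)" for u
    using wv below_trans below_antisym by blast
  note order = this up down
  show ?thesis
  proof (rule subdivision_in_if_order_embedding[OF pair_digraph_X' inj])
    show "?f ` pverts X'_graph \<subseteq> pverts G"
      unfolding img using verts by simp
    show "?f b \<preceq>\<^bsub>G\<^esub> ?f a" if "(a, b) \<in> parcs X'_graph" for a b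
      using that v w wv by (auto simp: X'_graph_def)
    show "c = a \<or> c = b" if "(a, b) \<in> parcs X'_graph" "c \<in> pverts X'_graph"
      "?f b \<preceq>\<^bsub>G\<^esub> ?f c" "?f c \<preceq>\<^bsub>G\<^esub> ?f a" for a b c
      using that ne incomp rel lr v w wv by (auto simp: X'_graph_def dest: below_antisym)
    show "u \<in> ?f ` pverts X'_graph"
      if "(a, b) \<in> parcs X'_graph" "(a', b') \<in> parcs X'_graph" "(a, b) \<noteq> (a', b')"
        "?f b \<preceq>\<^bsub>G\<^esub> u" "u \<preceq>\<^bsub>G\<^esub> ?f a" "?f b' \<preceq>\<^bsub>G\<^esub> u" "u \<preceq>\<^bsub>G\<^esub> ?f a'" for a b a' b' u
      unfolding img using that order by (auto simp: X'_graph_def dest: below_antisym)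
  qed (auto simp: roots_leaves_patterns)
qed

lemma ex_X_or_X'_subdivision:
  assumes r: "incomparable G r\<^sub>1 r\<^sub>2" and l: "incomparable G l\<^sub>1 l\<^sub>2"
    and lr: "l\<^sub>1 \<preceq>\<^bsub>G\<^esub> r\<^sub>1" "l\<^sub>1 \<preceq>\<^bsub>G\<^esub> r\<^sub>2" "l\<^sub>2 \<preceq>\<^bsub>G\<^esub> r\<^sub>1" "l\<^sub>2 \<preceq>\<^bsub>G\<^esub> r\<^sub>2"
    and join: "is_join {l\<^sub>1, l\<^sub>2} w"
  shows "\<exists>H. (subdivision_in X_graph G H \<or> subdivision_in X'_graph G H) \<and>
    leaves H = {l\<^sub>1, l\<^sub>2} \<and> roots H = {r\<^sub>1, r\<^sub>2}"
proof -
  \<comment> \<open>The roots are common ancestors of the leaves, so the join \<open>w\<close> lies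
    below both; a common ancestor of the leaves that is below \<open>w\<close> is also above
    \<open>w\<close>, hence equal to it.\<close>
  have w: "l\<^sub>1 \<preceq>\<^bsub>G\<^esub> w" "l\<^sub>2 \<preceq>\<^bsub>G\<^esub> w" "w \<preceq>\<^bsub>G\<^esub> r\<^sub>1" "w \<preceq>\<^bsub>G\<^esub> r\<^sub>2"
    and down: "\<And>u. l\<^sub>1 \<preceq>\<^bsub>G\<^esub> u \<Longrightarrow> l\<^sub>2 \<preceq>\<^bsub>G\<^esub> u \<Longrightarrow> u \<preceq>\<^bsub>G\<^esub> w \<Longrightarrow> u = w"
    using join lr below_verts below_antisym unfolding is_join_def by auto
  obtain v where "v \<in> maximal_in G {u \<in> pverts G. u \<preceq>\<^bsub>G\<^esub> r\<^sub>1 \<and> u \<preceq>\<^bsub>G\<^esub> r\<^sub>2}" and wv: "w \<preceq>\<^bsub>G\<^esub> v"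
    using ex_maximal_above[of w "{u \<in> pverts G. u \<preceq>\<^bsub>G\<^esub> r\<^sub>1 \<and> u \<preceq>\<^bsub>G\<^esub> r\<^sub>2}"] w below_verts by blast
  then have v: "v \<preceq>\<^bsub>G\<^esub> r\<^sub>1" "v \<preceq>\<^bsub>G\<^esub> r\<^sub>2"
    and up: "\<And>u. v \<preceq>\<^bsub>G\<^esub> u \<Longrightarrow> u \<preceq>\<^bsub>G\<^esub> r\<^sub>1 \<Longrightarrow> u \<preceq>\<^bsub>G\<^esub> r\<^sub>2 \<Longrightarrow> u = v"
    using below_verts unfolding maximal_in_def by auto
  show ?thesis
  proof (cases "w = v")
    case True
    then show ?thesis
      using ex_X_subdivision[OF r l v _ _ up] w down by blast
  next
    case False
    then show ?thesis
      using ex_X'_subdivision[OF r l v w(1,2) wv False up down] by blast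
  qed
qed

section \<open>From two minimal common ancestors to a strict \<open>K22\<close>-subdivision\<close>

lemma ex_strict_K22_subdivision:
  assumes r: "r\<^sub>1 \<in> LCA G {x, y}" "r\<^sub>2 \<in> LCA G {x, y}" "r\<^sub>1 \<noteq> r\<^sub>2"
  obtains H l\<^sub>1 l\<^sub>2 where "strict_K22_subdivision G H" "roots H = {r\<^sub>1, r\<^sub>2}" "leaves H = {l\<^sub>1, l\<^sub>2}"
    "x \<preceq>\<^bsub>G\<^esub> l\<^sub>1" "y \<preceq>\<^bsub>G\<^esub> l\<^sub>2"
proof -
  have xy: "x \<preceq>\<^bsub>G\<^esub> r\<^sub>1" "y \<preceq>\<^bsub>G\<^esub> r\<^sub>1" "x \<preceq>\<^bsub>G\<^esub> r\<^sub>2" "y \<preceq>\<^bsub>G\<^esub> r\<^sub>2"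
    and min: "\<And>u. x \<preceq>\<^bsub>G\<^esub> u \<Longrightarrow> y \<preceq>\<^bsub>G\<^esub> u \<Longrightarrow> u \<preceq>\<^bsub>G\<^esub> r\<^sub>1 \<Longrightarrow> u = r\<^sub>1"
      "\<And>u. x \<preceq>\<^bsub>G\<^esub> u \<Longrightarrow> y \<preceq>\<^bsub>G\<^esub> u \<Longrightarrow> u \<preceq>\<^bsub>G\<^esub> r\<^sub>2 \<Longrightarrow> u = r\<^sub>2"
    using r(1,2) below_verts unfolding LCA_def minimal_in_def by auto
  \<comment> \<open>The common lower bounds of the two roots: a maximal one above \<open>x\<close>
    becomes \<open>l\<^sub>1\<close>, a maximal one above \<open>y\<close> becomes
    \<open>l\<^sub>2\<close>.\<close>
  let ?D = "{u \<in> pverts G. u \<preceq>\<^bsub>G\<^esub> r\<^sub>1 \<and> u \<preceq>\<^bsub>G\<^esub> r\<^sub>2}"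
  have D: "\<exists>l. x' \<preceq>\<^bsub>G\<^esub> l \<and> l \<preceq>\<^bsub>G\<^esub> r\<^sub>1 \<and> l \<preceq>\<^bsub>G\<^esub> r\<^sub>2 \<and> (\<forall>u. l \<preceq>\<^bsub>G\<^esub> u \<longrightarrow> u \<preceq>\<^bsub>G\<^esub> r\<^sub>1 \<longrightarrow> u \<preceq>\<^bsub>G\<^esub> r\<^sub>2 \<longrightarrow> u = l)"
    if "x' \<preceq>\<^bsub>G\<^esub> r\<^sub>1" "x' \<preceq>\<^bsub>G\<^esub> r\<^sub>2" for x'
    using ex_maximal_above[of x' ?D] that below_verts unfolding maximal_in_def by blast
  obtain l\<^sub>1 where l1: "x \<preceq>\<^bsub>G\<^esub> l\<^sub>1" "l\<^sub>1 \<preceq>\<^bsub>G\<^esub> r\<^sub>1" "l\<^sub>1 \<preceq>\<^bsub>G\<^esub> r\<^sub>2"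
    and max1: "\<And>u. l\<^sub>1 \<preceq>\<^bsub>G\<^esub> u \<Longrightarrow> u \<preceq>\<^bsub>G\<^esub> r\<^sub>1 \<Longrightarrow> u \<preceq>\<^bsub>G\<^esub> r\<^sub>2 \<Longrightarrow> u = l\<^sub>1"
    using D[OF xy(1,3)] by blast
  obtain l\<^sub>2 where l2: "y \<preceq>\<^bsub>G\<^esub> l\<^sub>2" "l\<^sub>2 \<preceq>\<^bsub>G\<^esub> r\<^sub>1" "l\<^sub>2 \<preceq>\<^bsub>G\<^esub> r\<^sub>2"
    and max2: "\<And>u. l\<^sub>2 \<preceq>\<^bsub>G\<^esub> u \<Longrightarrow> u \<preceq>\<^bsub>G\<^esub> r\<^sub>1 \<Longrightarrow> u \<preceq>\<^bsub>G\<^esub> r\<^sub>2 \<Longrightarrow> u = l\<^sub>2"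
    using D[OF xy(2,4)] by blast
  \<comment> \<open>A vertex above \<open>l\<^sub>1\<close> and \<open>l\<^sub>2\<close> is a common
    ancestor of \<open>x\<close> and \<open>y\<close>, so the minimality of \<open>r\<^sub>1\<close>
    applies to it.\<close>
  have min': "u = r\<^sub>1" if "l\<^sub>1 \<preceq>\<^bsub>G\<^esub> u" "l\<^sub>2 \<preceq>\<^bsub>G\<^esub> u" "u \<preceq>\<^bsub>G\<^esub> r\<^sub>1" for u
    using min(1) that l1(1) l2(1) below_trans by blast
  have min'': "u = r\<^sub>2" if "l\<^sub>1 \<preceq>\<^bsub>G\<^esub> u" "l\<^sub>2 \<preceq>\<^bsub>G\<^esub> u" "u \<preceq>\<^bsub>G\<^esub> r\<^sub>2" for u
    using min(2) that l1(1) l2(1) below_trans by blast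
  have verts: "r\<^sub>1 \<in> pverts G" "r\<^sub>2 \<in> pverts G" "l\<^sub>1 \<in> pverts G" "l\<^sub>2 \<in> pverts G"
    using l1 l2 below_verts by blast+
  \<comment> \<open>A root below the other one is above both leaves, so the two would be equal by
    minimality. If one leaf lay below the other, the upper leaf would equal both roots.\<close>
  have incomp: "\<not> r\<^sub>1 \<preceq>\<^bsub>G\<^esub> r\<^sub>2" "\<not> r\<^sub>2 \<preceq>\<^bsub>G\<^esub> r\<^sub>1" "\<not> l\<^sub>1 \<preceq>\<^bsub>G\<^esub> l\<^sub>2" "\<not> l\<^sub>2 \<preceq>\<^bsub>G\<^esub> l\<^sub>1"
    using min' min'' l1 l2 r(3) verts below_refl by metis+
  have ne: "l\<^sub>1 \<noteq> l\<^sub>2" "l\<^sub>1 \<noteq> r\<^sub>1" "l\<^sub>1 \<noteq> r\<^sub>2" "l\<^sub>2 \<noteq> r\<^sub>1" "l\<^sub>2 \<noteq> r\<^sub>2"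
    using incomp l1 l2 verts below_refl by blast+
  note ne = ne ne[symmetric] r(3) r(3)[symmetric]
  let ?f = "(!) [r\<^sub>1, r\<^sub>2, l\<^sub>1, l\<^sub>2]"
  have img: "?f ` pverts K22 = {r\<^sub>1, r\<^sub>2, l\<^sub>1, l\<^sub>2}"
    by (auto simp: K22_def)
  have inj: "inj_on ?f (pverts K22)"
    using ne by (auto simp: K22_def)
  obtain H where H: "subdivision_in K22 G H" "roots H = {r\<^sub>1, r\<^sub>2}" "leaves H = {l\<^sub>1, l\<^sub>2}"
  proof (rule subdivision_in_if_order_embedding[OF pair_digraph_K22 inj])
    show "?f ` pverts K22 \<subseteq> pverts G"
      unfolding img using verts by simp
    show "?f b \<preceq>\<^bsub>G\<^esub> ?f a" if "(a, b) \<in> parcs K22" for a b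
      using that l1 l2 by (auto simp: K22_def)
    show "c = a \<or> c = b" if "(a, b) \<in> parcs K22" "c \<in> pverts K22"
      "?f b \<preceq>\<^bsub>G\<^esub> ?f c" "?f c \<preceq>\<^bsub>G\<^esub> ?f a" for a b c
      using that incomp by (auto simp: K22_def)
    \<comment> \<open>Paths from both roots to one leaf meet only there, by maximality of that leaf;
      a vertex above both leaves and below a root is that root.\<close>
    show "u \<in> ?f ` pverts K22"
      if "(a, b) \<in> parcs K22" "(a', b') \<in> parcs K22" "(a, b) \<noteq> (a', b')"
        "?f b \<preceq>\<^bsub>G\<^esub> u" "u \<preceq>\<^bsub>G\<^esub> ?f a" "?f b' \<preceq>\<^bsub>G\<^esub> u" "u \<preceq>\<^bsub>G\<^esub> ?f a'" for a b a' b' u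
      unfolding img using that max1 max2 min' min'' by (auto simp: K22_def)
  qed (auto simp: roots_leaves_patterns)
  then have "strict_K22_subdivision G H"
    using incomp by (auto simp: strict_K22_subdivision_def incomparable_def)
  then show ?thesis
    using that H(2,3) l1(1) l2(1) by blast
qed

end

section \<open>Common ancestors in a network, and the equivalence\<close>

lemma (in network) ex_top: "\<exists>t. \<forall>v \<in> pverts G. v \<preceq>\<^bsub>G\<^esub> t"
proof -
  obtain t where "roots G = {t}"
    using unique_root by (auto simp: card_1_singleton_iff)
  \<comment> \<open>In a finite order each vertex lies below some maximal one, and \<open>t\<close>
    is the only root.\<close>
  then have "v \<preceq>\<^bsub>G\<^esub> t" if "v \<in> pverts G" for v
    using ex_maximal_above[OF that order.refl] by (simp add: roots_def)
  then show ?thesis by blast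
qed

theorem theorem4p4:
  fixes N :: "'a pair_pre_digraph"
  assumes "network N"
  shows "global_lca_property N \<longleftrightarrow>
    (\<forall>H. strict_K22_subdivision N H \<longrightarrow>
      (\<exists>H'. (subdivision_in X_graph N H' \<or> subdivision_in X'_graph N H') \<and>
            leaves H' = leaves H \<and> roots H' = roots H))"
    (is "_ \<longleftrightarrow> (\<forall>H. _ \<longrightarrow> ?X H)")
proof -
  interpret network N by fact
  show ?thesis
  proof (intro iffI allI impI)
    fix H assume lca: "global_lca_property N" and "strict_K22_subdivision N H"
    from this(2) obtain r\<^sub>1 r\<^sub>2 l\<^sub>1 l\<^sub>2 where H: "roots H = {r\<^sub>1, r\<^sub>2}" "leaves H = {l\<^sub>1, l\<^sub>2}"
      and incomp: "incomparable N r\<^sub>1 r\<^sub>2" "incomparable N l\<^sub>1 l\<^sub>2"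
      and lr: "l\<^sub>1 \<preceq>\<^bsub>N\<^esub> r\<^sub>1" "l\<^sub>1 \<preceq>\<^bsub>N\<^esub> r\<^sub>2" "l\<^sub>2 \<preceq>\<^bsub>N\<^esub> r\<^sub>1" "l\<^sub>2 \<preceq>\<^bsub>N\<^esub> r\<^sub>2"
      by (rule strict_K22_subdivision_branch_vertices)
    obtain w where "is_join {l\<^sub>1, l\<^sub>2} w"
      using lca lr below_verts unfolding global_lca_property_iff_pairs by blast
    then show "?X H"
      unfolding H by (rule ex_X_or_X'_subdivision[OF incomp lr])
  next
    assume X: "\<forall>H. strict_K22_subdivision N H \<longrightarrow> ?X H"
    have unique: "r\<^sub>1 = r\<^sub>2" if r: "r\<^sub>1 \<in> LCA N {x, y}" "r\<^sub>2 \<in> LCA N {x, y}" for x y r\<^sub>1 r\<^sub>2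
    proof (rule ccontr)
      assume "r\<^sub>1 \<noteq> r\<^sub>2"
      with r obtain H l\<^sub>1 l\<^sub>2 where "strict_K22_subdivision N H"
        and H: "roots H = {r\<^sub>1, r\<^sub>2}" "leaves H = {l\<^sub>1, l\<^sub>2}" and l: "x \<preceq>\<^bsub>N\<^esub> l\<^sub>1" "y \<preceq>\<^bsub>N\<^esub> l\<^sub>2"
        by (rule ex_strict_K22_subdivision)
      with X obtain H' where H': "subdivision_in X_graph N H' \<or> subdivision_in X'_graph N H'"
        "leaves H' = {l\<^sub>1, l\<^sub>2}" "roots H' = {r\<^sub>1, r\<^sub>2}" by metis
      from H'(1) obtain m where "\<forall>r \<in> roots H'. m \<preceq>\<^bsub>N\<^esub> r" "\<forall>l \<in> leaves H'. l \<preceq>\<^bsub>N\<^esub> m"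
        by (rule X_subdivision_middle_vertex)
      with H'(2,3) have m: "m \<preceq>\<^bsub>N\<^esub> r\<^sub>1" "m \<preceq>\<^bsub>N\<^esub> r\<^sub>2" "x \<preceq>\<^bsub>N\<^esub> m" "y \<preceq>\<^bsub>N\<^esub> m"
        using l below_trans by auto
      \<comment> \<open>\<open>m\<close> is a common ancestor of \<open>x\<close> and
        \<open>y\<close> below two minimal ones, hence equal to each of them.\<close>
      then have "m = r\<^sub>1" "m = r\<^sub>2"
        using r below_verts unfolding LCA_def minimal_in_def by auto
      with \<open>r\<^sub>1 \<noteq> r\<^sub>2\<close> show False by simp
    qed
    have "card (LCA N {x, y}) = 1" if xy: "x \<in> pverts N" "y \<in> pverts N" for x y
    proof -
      \<comment> \<open>The root is above both vertices, so their common ancestors form a nonempty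
        set, which has a minimal element.\<close>
      obtain t where "x \<preceq>\<^bsub>N\<^esub> t" "y \<preceq>\<^bsub>N\<^esub> t"
        using ex_top xy by blast
      then obtain r where "r \<in> LCA N {x, y}"
        using ex_minimal_below[of t "{v \<in> pverts N. \<forall>a \<in> {x, y}. a \<preceq>\<^bsub>N\<^esub> v}"] below_verts
        unfolding LCA_def by auto
      with unique have "LCA N {x, y} = {r}" by blast
      then show ?thesis by simp
    qed
    then show "global_lca_property N"
      unfolding global_lca_property_iff_pairs card_LCA_eq_1_iff by blast
  qed
qed

end
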